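(* Let $U$ be a linear operator (not assumed densely defined, closed or bounded) in a real or complex Hilbert space $\mathcal{H}$ such that $\ker U=\{0\}$. The following assertions are equivalent: (i) $U$ is a unitary operator, i.e. $U$ is an everywhere defined bounded operator such that $U^*=U^{-1}$. (ii) $U\wedge U^{-1}$ and $G(U)^{\perp}\subseteq\operatorname{ran}M_{U,U^{-1}}$. (iii) $U$ is densely defined and $U^*=U^{-1}$. (iv) $U$ is densely defined and closed with dense range, and $U^{-1}\subset U^*$.
   Context: Linear operators are defined on linear subspaces; $U^{-1}$ is the inverse operator with domain $\operatorname{ran}U$; equality of operators includes equality of domains, and $A\subset B$ means $B$ extends $A$ (possibly $A=B$). $U\wedge U^{-1}$ means $(Uh\mid k)=(h\mid U^{-1}k)$ for all $h\in\operatorname{dom}U$, $k\in\operatorname{ran}U$. $G(U)=\{(h,Uh):h\in\operatorname{dom}U\}$ is the graph and $\perp$ is taken in the product Hilbert space $\mathcal{H}\times\mathcal{H}$. $M_{U,U^{-1}}$ is the operator in $\mathcal{H}\times\mathcal{H}$ with domain $\operatorname{dom}U\times\operatorname{ran}U$ given by $M_{U,U^{-1}}(h,k)=(h-U^{-1}k,\,Uh+k)$. *)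

theory Defs
  imports "HOL-Analysis.Analysis"
begin

text \<open>
  The scalar field is \<open>\<real>\<close> or \<open>\<complex>\<close>: a real algebra identified, by
  \<open>to_complex\<close>, with the subfield \<open>\<real>\<close> of \<open>\<complex>\<close> or with all of \<open>\<complex>\<close>.
\<close>

class real_or_complex = real_field +
  fixes to_complex :: "'a \<Rightarrow> complex"
  assumes to_complex_inject: "to_complex x = to_complex y \<Longrightarrow> x = y"
    and to_complex_add: "to_complex (x + y) = to_complex x + to_complex y"
    and to_complex_mult: "to_complex (x * y) = to_complex x * to_complex y"
    and to_complex_scaleR_one: "to_complex (r *\<^sub>R 1) = complex_of_real r"
    and range_to_complex: "range to_complex = \<real> \<or> range to_complex = UNIV"

instantiation real :: real_or_complex
begin

definition to_complex_real :: "real \<Rightarrow> complex"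
  where "to_complex_real = complex_of_real"

instance
  by standard (auto simp: to_complex_real_def Reals_def)

end

instantiation complex :: real_or_complex
begin

definition to_complex_complex :: "complex \<Rightarrow> complex"
  where "to_complex_complex z = z"

instance
  by standard (auto simp: to_complex_complex_def scaleR_conv_of_real)

end

text \<open>
  The topology and completeness are those of the Banach space type \<open>'h\<close>, whose norm is
  required to be the one induced by the inner product. The inner product is linear in its
  first argument.
\<close>

locale hilbert_space = vector_space smul
  for smul :: "'k::real_or_complex \<Rightarrow> 'h::banach \<Rightarrow> 'h" +
  fixes ip :: "'h \<Rightarrow> 'h \<Rightarrow> 'k"
  assumes smul_of_real: "smul (of_real r) x = r *\<^sub>R x"
    and ip_add_left: "ip (x + y) z = ip x z + ip y z"
    and ip_smul_left: "ip (smul c x) y = c * ip x y"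
    and ip_cnj: "to_complex (ip y x) = cnj (to_complex (ip x y))"
    and ip_self: "ip x x = of_real ((norm x)\<^sup>2)"

lemma hilbert_space_real_inner:
  "hilbert_space scaleR (inner :: 'a::{real_inner, banach} \<Rightarrow> 'a \<Rightarrow> real)"
  by unfold_locales
    (auto simp: algebra_simps inner_left_distrib to_complex_real_def inner_commute
      power2_norm_eq_inner)

lemma hilbert_space_complex:
  "hilbert_space ((*) :: complex \<Rightarrow> complex \<Rightarrow> complex) (\<lambda>x y. x * cnj y)"
  by unfold_locales
    (auto simp: algebra_simps to_complex_complex_def scaleR_conv_of_real complex_norm_square
       simp flip: of_real_power)

definition smul_prod :: "('k \<Rightarrow> 'h \<Rightarrow> 'h) \<Rightarrow> 'k \<Rightarrow> 'h \<times> 'h \<Rightarrow> 'h \<times> 'h"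
  where "smul_prod smul c p = (smul c (fst p), smul c (snd p))"

definition ip_prod :: "('h \<Rightarrow> 'h \<Rightarrow> 'k::plus) \<Rightarrow> 'h \<times> 'h \<Rightarrow> 'h \<times> 'h \<Rightarrow> 'k"
  where "ip_prod ip p q = ip (fst p) (fst q) + ip (snd p) (snd q)"

lemma (in hilbert_space) hilbert_space_prod:
  "hilbert_space (smul_prod smul) (ip_prod ip)"
proof unfold_locales
  fix p q :: "'h \<times> 'h"
  show "to_complex (ip_prod ip q p) = cnj (to_complex (ip_prod ip p q))"
    unfolding ip_prod_def to_complex_add complex_cnj_add
    by (simp add: ip_cnj[symmetric])
qed (auto simp: smul_prod_def ip_prod_def scale_right_distrib scale_left_distrib
    smul_of_real ip_add_left ip_smul_left ip_self norm_prod_def algebra_simps prod_eq_iff)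

definition orth_compl :: "('a \<Rightarrow> 'a \<Rightarrow> 'k::zero) \<Rightarrow> 'a set \<Rightarrow> 'a set"
  where "orth_compl ip S = {x. \<forall>y\<in>S. ip y x = 0}"

text \<open>
  An operator is a partial map \<open>U :: 'h \<rightharpoonup> 'h\<close>, so that \<open>dom U\<close>, \<open>ran U\<close> and
  \<open>Map.graph U\<close> are its domain, range and graph, equality includes equality of domains,
  and \<open>A \<subseteq>\<^sub>m B\<close> says that \<open>B\<close> extends \<open>A\<close>.
\<close>

definition linear_operator :: "('k::field \<Rightarrow> 'h::ab_group_add \<Rightarrow> 'h) \<Rightarrow> ('h \<rightharpoonup> 'h) \<Rightarrow> bool"
  where "linear_operator smul U \<longleftrightarrow>
    module.subspace smul (dom U) \<and>
    (\<forall>x\<in>dom U. \<forall>y\<in>dom U. the (U (x + y)) = the (U x) + the (U y)) \<and>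
    (\<forall>c. \<forall>x\<in>dom U. the (U (smul c x)) = smul c (the (U x)))"

definition ker :: "('h \<rightharpoonup> 'h::zero) \<Rightarrow> 'h set"
  where "ker U = {h \<in> dom U. the (U h) = 0}"

text \<open>Meaningful only for injective \<open>U\<close>.\<close>

definition inverse_op :: "('h \<rightharpoonup> 'h) \<Rightarrow> ('h \<rightharpoonup> 'h)"
  where "inverse_op U = (\<lambda>k. if k \<in> ran U then Some (THE h. U h = Some k) else None)"

lemma dom_inverse_op: "dom (inverse_op U) = ran U"
  by (auto simp: inverse_op_def dom_def)

definition densely_defined :: "('h::topological_space \<rightharpoonup> 'h) \<Rightarrow> bool"
  where "densely_defined U \<longleftrightarrow> closure (dom U) = UNIV"

definition dense_range :: "('h::topological_space \<rightharpoonup> 'h) \<Rightarrow> bool"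
  where "dense_range U \<longleftrightarrow> closure (ran U) = UNIV"

definition closed_op :: "('h::topological_space \<rightharpoonup> 'h) \<Rightarrow> bool"
  where "closed_op U \<longleftrightarrow> closed (Map.graph U)"

definition bounded_op :: "('h::real_normed_vector \<rightharpoonup> 'h) \<Rightarrow> bool"
  where "bounded_op U \<longleftrightarrow> (\<exists>C. \<forall>h\<in>dom U. norm (the (U h)) \<le> C * norm h)"

text \<open>Meaningful only for densely defined \<open>U\<close>, where the vector \<open>l\<close> is unique.\<close>

definition adjoint_op :: "('h \<Rightarrow> 'h \<Rightarrow> 'k) \<Rightarrow> ('h \<rightharpoonup> 'h) \<Rightarrow> ('h \<rightharpoonup> 'h)"
  where "adjoint_op ip U = (\<lambda>k.
    if \<exists>l. \<forall>h\<in>dom U. ip (the (U h)) k = ip h l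
    then Some (THE l. \<forall>h\<in>dom U. ip (the (U h)) k = ip h l)
    else None)"

text \<open>The relation \<open>A \<and> B\<close> of being adjoint to each other.\<close>

definition adjoint_to_each_other :: "('h \<Rightarrow> 'h \<Rightarrow> 'k) \<Rightarrow> ('h \<rightharpoonup> 'h) \<Rightarrow> ('h \<rightharpoonup> 'h) \<Rightarrow> bool"
  where "adjoint_to_each_other ip A B \<longleftrightarrow>
    (\<forall>h\<in>dom A. \<forall>k\<in>dom B. ip (the (A h)) k = ip h (the (B k)))"

definition M_op :: "('h \<rightharpoonup> 'h) \<Rightarrow> ('h \<rightharpoonup> 'h) \<Rightarrow> ('h \<times> 'h \<rightharpoonup> 'h \<times> 'h::ab_group_add)"
  where "M_op A B = (\<lambda>(h, k).
    if h \<in> dom A \<and> k \<in> dom B then Some (h - the (B k), the (A h) + k) else None)"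

definition unitary_op :: "('h::real_normed_vector \<Rightarrow> 'h \<Rightarrow> 'k) \<Rightarrow> ('h \<rightharpoonup> 'h) \<Rightarrow> bool"
  where "unitary_op ip U \<longleftrightarrow>
    dom U = UNIV \<and> bounded_op U \<and> adjoint_op ip U = inverse_op U"

definition all_equivalent :: "bool list \<Rightarrow> bool"
  where "all_equivalent Ps \<longleftrightarrow> (\<forall>P\<in>set Ps. \<forall>Q\<in>set Ps. P \<longleftrightarrow> Q)"

end

theory Submission
  imports Defs
begin

text \<open>
  Since every vector of \<open>ran U\<close> is some \<open>U g\<close>, the relation \<open>U \<and> U\<inverse>\<close> says that \<open>U\<close>
  preserves inner products. Under it, \<open>M (h, U g) = (h - g, U h + U g)\<close> is orthogonal to
  \<open>(d, U d)\<close> iff \<open>d \<bottom> 2 h\<close>; hence a vector of \<open>ran M\<close> orthogonal to \<open>G(U)\<close> has the form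
  \<open>(- g, U g)\<close>, and (ii) gives both density of \<open>dom U\<close> and \<open>U\<^sup>* \<subset> U\<inverse>\<close>. In the
  remaining implications, a closed isometry has closed domain and closed range, so that density
  of either one means that it is the whole space.
\<close>

section \<open>Preliminaries on reals and scalars\<close>

lemma nonneg_quadratic_imp_linear_coeff_zero:
  fixes r q :: real
  assumes q: "q \<ge> 0" and nonneg: "\<And>t. t\<^sup>2 * q - 2 * t * r \<ge> 0"
  shows "r = 0"
proof (rule ccontr)
  assume "r \<noteq> 0"
  \<comment> \<open>The minimiser would be \<open>r / q\<close>; dividing by \<open>q + 1\<close>
    also covers \<open>q = 0\<close> and still makes the quadratic negative.\<close>
  define t where "t = r / (q + 1)"
  have r: "r = t * (q + 1)" and t: "t \<noteq> 0"
    using q \<open>r \<noteq> 0\<close> by (auto simp: t_def)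
  have "t\<^sup>2 * q - 2 * t * r = - (t\<^sup>2 * (q + 2))"
    unfolding r by (simp add: power2_eq_square algebra_simps)
  moreover have "t\<^sup>2 * (q + 2) > 0"
    using q t by simp
  ultimately show False
    using nonneg[of t] by linarith
qed

lemma to_complex_0 [simp]: "to_complex 0 = 0"
  using to_complex_add[of 0 0] by simp

lemma to_complex_diff: "to_complex (x - y) = to_complex x - to_complex y"
  using to_complex_add[of "x - y" y] by simp

lemma to_complex_of_real [simp]: "to_complex (of_real r) = complex_of_real r"
  by (simp add: of_real_def[where 'a='a] to_complex_scaleR_one)

section \<open>The inner product and its real part\<close>

context hilbert_space
begin

lemma ip_add_right: "ip x (y + z) = ip x y + ip x z"
  by (rule to_complex_inject)
    (simp add: ip_cnj[of x y] ip_cnj[of x z] ip_cnj[of x "y + z"] ip_add_left to_complex_add)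

lemma ip_zero_left [simp]: "ip 0 x = 0"
  using ip_add_left[of 0 0 x] by simp

lemma ip_zero_right [simp]: "ip x 0 = 0"
  using ip_add_right[of x 0 0] by simp

lemma ip_diff_left: "ip (x - y) z = ip x z - ip y z"
  using ip_add_left[of "x - y" y z] by simp

lemma ip_diff_right: "ip x (y - z) = ip x y - ip x z"
  using ip_add_right[of x "y - z" z] by simp

lemma ip_minus_right: "ip x (- y) = - ip x y"
  using ip_diff_right[of x 0 y] by simp

text \<open>A real inner product inducing the same norm, so that order and limit arguments can be
  made for both scalar fields at once.\<close>

definition rip :: "'h \<Rightarrow> 'h \<Rightarrow> real"
  where "rip x y = Re (to_complex (ip x y))"

lemma rip_self: "rip x x = (norm x)\<^sup>2"
  by (simp add: rip_def ip_self del: of_real_power)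

lemma rip_commute: "rip x y = rip y x"
  by (simp add: rip_def ip_cnj[of x y])

lemma rip_add_left: "rip (x + y) z = rip x z + rip y z"
  by (simp add: rip_def ip_add_left to_complex_add)

lemma rip_diff_left: "rip (x - y) z = rip x z - rip y z"
  by (simp add: rip_def ip_diff_left to_complex_diff)

lemma rip_scaleR_left: "rip (r *\<^sub>R x) y = r * rip x y"
  by (simp add: rip_def smul_of_real[symmetric] ip_smul_left to_complex_mult)

lemma rip_add_right: "rip z (x + y) = rip z x + rip z y"
  and rip_diff_right: "rip z (x - y) = rip z x - rip z y"
  and rip_scaleR_right: "rip x (r *\<^sub>R y) = r * rip x y"
  using rip_add_left[of x y z] rip_diff_left[of x y z] rip_scaleR_left[of r y x]
  by (simp_all only: rip_commute[of z "x + y"] rip_commute[of z "x - y"] rip_commute[of x "r *\<^sub>R y"]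
      rip_commute[of z x] rip_commute[of z y] rip_commute[of x y])

lemmas rip_simps = rip_add_left rip_add_right rip_diff_left rip_diff_right
  rip_scaleR_left rip_scaleR_right

text \<open>Serves to derive continuity of \<open>rip\<close> from that of the norm.\<close>

lemma rip_polarization: "rip x y = ((norm (x + y))\<^sup>2 - (norm (x - y))\<^sup>2) / 4"
  by (simp add: rip_self[symmetric] rip_simps rip_commute)

lemma tendsto_rip:
  assumes "(f \<longlongrightarrow> x) F" "(g \<longlongrightarrow> y) F"
  shows "((\<lambda>n. rip (f n) (g n)) \<longlongrightarrow> rip x y) F"
  unfolding rip_polarization by (intro tendsto_intros assms; simp)

text \<open>
  Reduces identities between values of \<open>ip\<close> to real ones, as \<open>'k\<close> carries no topology.
\<close>

lemma ip_eq_iff_rip: "ip x y = ip x' y' \<longleftrightarrow> (\<forall>c. rip (smul c x) y = rip (smul c x') y')"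
proof
  assume *: "\<forall>c. rip (smul c x) y = rip (smul c x') y'"
  define z where "z = to_complex (ip x y) - to_complex (ip x' y')"
  have "Re (cnj z * z) = 0"
    \<comment> \<open>This scalar is the conjugate of \<open>z\<close>, so the hypothesis at it says
      that the squared modulus of \<open>z\<close> vanishes.\<close>
    using *[THEN spec, of "ip y x - ip y' x'"]
    by (simp add: z_def rip_def ip_smul_left to_complex_mult to_complex_diff ip_cnj[of y x]
        ip_cnj[of y' x'] right_diff_distrib del: complex_cnj_diff)
  then have "z = 0"
    by (simp add: complex_eq_iff power2_eq_square[symmetric])
  then show "ip x y = ip x' y'"
    by (simp add: z_def to_complex_inject)
qed (simp add: rip_def ip_smul_left)

section \<open>Nearest points and density of subspaces\<close>

text \<open>The parallelogram law for \<open>z - x\<close> and \<open>z - y\<close>, solved for the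
  distance of \<open>x\<close> and \<open>y\<close>: two nearly nearest points to \<open>z\<close>
  are close once their midpoint is not much nearer.\<close>

lemma parallelogram:
  fixes x y z :: 'h
  shows "(norm (x - y))\<^sup>2 =
    2 * (norm (z - x))\<^sup>2 + 2 * (norm (z - y))\<^sup>2 - 4 * (norm (z - (1/2) *\<^sub>R (x + y)))\<^sup>2"
  by (simp add: rip_self[symmetric] rip_simps rip_commute field_simps)

lemma subspace_scaleR: "subspace S \<Longrightarrow> x \<in> S \<Longrightarrow> r *\<^sub>R x \<in> S"
  using subspace_scale[of S x "of_real r"] by (simp add: smul_of_real)

text \<open>A minimising sequence is Cauchy: midpoints of its terms stay in \<open>S\<close>, hence
  at distance at least \<open>d\<close> from \<open>x\<close>, and the parallelogram law applies.
  Completeness supplies the limit.\<close>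

lemma closure_nearest_point:
  assumes S: "subspace S"
  obtains y where "y \<in> closure S" "norm (x - y) \<le> infdist x S"
proof -
  have ne: "S \<noteq> {}"
    using subspace_0[OF S] by auto
  define d where "d = infdist x S"
  have d0: "d \<ge> 0"
    by (simp add: d_def infdist_nonneg)
  have le: "d \<le> norm (x - s)" if "s \<in> S" for s
    using infdist_le[OF that, of x] by (simp add: d_def dist_norm)
  have "\<exists>s\<in>S. norm (x - s) < d + 1 / real (Suc n)" for n
  proof -
    have "(INF a\<in>S. dist x a) < d + 1 / real (Suc n)"
      using ne by (simp add: d_def infdist_def)
    then show ?thesis
      using ne by (subst (asm) cINF_less_iff) (auto simp: dist_norm intro!: bdd_belowI2[of _ 0])
  qed
  then obtain s where s: "\<And>n. s n \<in> S" "\<And>n. norm (x - s n) < d + 1 / real (Suc n)"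
    by metis
  have lim: "(\<lambda>n. norm (x - s n)) \<longlonglongrightarrow> d"
  proof (rule tendsto_sandwich)
    show "\<forall>\<^sub>F n in sequentially. d \<le> norm (x - s n)"
      using le[OF s(1)] by (intro always_eventually allI)
    show "\<forall>\<^sub>F n in sequentially. norm (x - s n) \<le> d + 1 / real (Suc n)"
      using less_imp_le[OF s(2)] by (intro always_eventually allI)
    show "(\<lambda>n. d + 1 / real (Suc n)) \<longlonglongrightarrow> d"
      using tendsto_add[OF tendsto_const LIMSEQ_inverse_real_of_nat, of d]
      by (simp add: inverse_eq_divide)
  qed simp
  have "Cauchy s"
  proof (rule metric_CauchyI)
    fix e :: real assume e: "e > 0"
    have "(\<lambda>n. (norm (x - s n))\<^sup>2) \<longlonglongrightarrow> d\<^sup>2"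
      by (intro tendsto_intros lim)
    \<comment> \<open>The margin is chosen so that the parallelogram law, with two terms of weight 2
      minus four times the square of \<open>d\<close>, leaves exactly the square of
      \<open>e\<close>.\<close>
    moreover have "d\<^sup>2 < d\<^sup>2 + e\<^sup>2 / 4"
      using e by simp
    ultimately obtain N where N: "\<And>n. n \<ge> N \<Longrightarrow> (norm (x - s n))\<^sup>2 < d\<^sup>2 + e\<^sup>2 / 4"
      by (metis (no_types, lifting) order_tendstoD(2) eventually_sequentially)
    have "dist (s m) (s n) < e" if "m \<ge> N" "n \<ge> N" for m n
    proof -
      have "d \<le> norm (x - (1/2) *\<^sub>R (s m + s n))"
        by (intro le subspace_scaleR[OF S] subspace_add[OF S] s)
      then have "d\<^sup>2 \<le> (norm (x - (1/2) *\<^sub>R (s m + s n)))\<^sup>2"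
        using d0 by (simp add: power_mono)
      then have "(norm (s m - s n))\<^sup>2 < e\<^sup>2"
        using N[OF that(1)] N[OF that(2)] parallelogram[of "s m" "s n" x] by linarith
      then show ?thesis
        using e by (simp add: dist_norm power_less_imp_less_base)
    qed
    then show "\<exists>M. \<forall>m\<ge>M. \<forall>n\<ge>M. dist (s m) (s n) < e"
      by blast
  qed
  then obtain y where y: "s \<longlonglongrightarrow> y"
    by (auto simp: Cauchy_convergent_iff convergent_def)
  have "y \<in> closure S"
    using s y by (auto simp: closure_sequential)
  moreover have "(\<lambda>n. norm (x - s n)) \<longlonglongrightarrow> norm (x - y)"
    by (intro tendsto_intros y)
  then have "norm (x - y) = d"
    using lim LIMSEQ_unique by blast
  ultimately show thesis
    using that by (simp add: d_def)
qed

text \<open>If \<open>y\<close> is a point of \<open>closure S\<close> nearest to \<open>x\<close>,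
  the first variation makes \<open>x - y\<close> orthogonal to \<open>S\<close>, hence zero.\<close>

lemma closure_subspace_eq_UNIV:
  assumes S: "subspace S" and orth: "orth_compl ip S \<subseteq> {0}"
  shows "closure S = UNIV"
proof -
  have "x \<in> closure S" for x
  proof -
    obtain y where y: "y \<in> closure S" "norm (x - y) \<le> infdist x S"
      using closure_nearest_point[OF S] by blast
    obtain a where a: "\<And>n. a n \<in> S" "a \<longlonglongrightarrow> y"
      using y(1) by (auto simp: closure_sequential)
    have rip0: "rip s (x - y) = 0" if s: "s \<in> S" for s
    proof (rule nonneg_quadratic_imp_linear_coeff_zero[where q = "(norm s)\<^sup>2"])
      show "t\<^sup>2 * (norm s)\<^sup>2 - 2 * t * rip s (x - y) \<ge> 0" for t
      proof -
        \<comment> \<open>Since \<open>y\<close> lies only in the closure, the variation is made at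
          \<open>a n\<close> in \<open>S\<close> and then passed to the limit.\<close>
        have "infdist x S \<le> norm (x - (a n + t *\<^sub>R s))" for n
          using infdist_le[of "a n + t *\<^sub>R s" S x] a s S
          by (simp add: dist_norm subspace_add subspace_scaleR)
        moreover have "(\<lambda>n. norm (x - (a n + t *\<^sub>R s))) \<longlonglongrightarrow> norm (x - (y + t *\<^sub>R s))"
          by (intro tendsto_intros a)
        ultimately have "infdist x S \<le> norm (x - (y + t *\<^sub>R s))"
          using LIMSEQ_le_const by blast
        then have "norm (x - y) \<le> norm ((x - y) - t *\<^sub>R s)"
          using y(2) by (simp add: algebra_simps)
        then have "(norm (x - y))\<^sup>2 \<le> (norm ((x - y) - t *\<^sub>R s))\<^sup>2"
          by (simp add: power_mono)
        also have "\<dots> = (norm (x - y))\<^sup>2 - 2 * t * rip s (x - y) + t\<^sup>2 * (norm s)\<^sup>2"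
          unfolding rip_self[symmetric] rip_diff_left[of "x - y"] rip_diff_right[of _ "x - y"]
          by (simp only: rip_scaleR_left rip_scaleR_right rip_commute[of "x - y" s])
            (simp add: power2_eq_square algebra_simps)
        finally show ?thesis
          by simp
      qed
    qed simp
    \<comment> \<open>Vanishing real parts suffice, because \<open>S\<close> contains every multiple
      \<open>smul c s\<close>.\<close>
    have "ip s (x - y) = ip 0 (x - y)" if "s \<in> S" for s
      unfolding ip_eq_iff_rip
    proof
      show "rip (smul c s) (x - y) = rip (smul c 0) (x - y)" for c
        using rip0[OF subspace_scale[OF S that, of c]] by (simp add: rip_def)
    qed
    then have "x - y \<in> orth_compl ip S"
      by (auto simp: orth_compl_def)
    then show ?thesis
      using orth y by auto
  qed
  then show ?thesis
    by auto
qed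

text \<open>By continuity \<open>x - y\<close> is orthogonal to the closure of \<open>S\<close>,
  hence to itself. This gives uniqueness of the values of the adjoint.\<close>

lemma dense_orthogonal_imp_eq:
  assumes "closure S = UNIV" and "\<And>d. d \<in> S \<Longrightarrow> ip d x = ip d y"
  shows "x = y"
proof -
  obtain s where s: "\<And>n. s n \<in> S" "s \<longlonglongrightarrow> x - y"
    using assms(1) closure_sequential[of "x - y" S] by auto
  have "rip (s n) (x - y) = 0" for n
    using assms(2)[OF s(1), of n] by (simp add: rip_def ip_diff_right)
  moreover have "(\<lambda>n. rip (s n) (x - y)) \<longlonglongrightarrow> rip (x - y) (x - y)"
    by (intro tendsto_rip s tendsto_const)
  ultimately have "rip (x - y) (x - y) = 0"
    by (simp add: LIMSEQ_const_iff)
  then show ?thesis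
    by (simp add: rip_self)
qed

end

section \<open>Operators with trivial kernel and their inverses\<close>

locale injective_operator = hilbert_space smul ip
  for smul :: "'k::real_or_complex \<Rightarrow> 'h::banach \<Rightarrow> 'h" and ip +
  fixes U :: "'h \<rightharpoonup> 'h"
  assumes lin: "linear_operator smul U" and ker: "ker U = {0}"
begin

abbreviation ap :: "'h \<Rightarrow> 'h"
  where "ap h \<equiv> the (U h)"

lemma subspace_dom: "subspace (dom U)"
  and ap_add: "x \<in> dom U \<Longrightarrow> y \<in> dom U \<Longrightarrow> ap (x + y) = ap x + ap y"
  and ap_smul: "x \<in> dom U \<Longrightarrow> ap (smul c x) = smul c (ap x)"
  using lin by (auto simp: linear_operator_def)

lemma ap_0 [simp]: "ap 0 = 0" and dom_0 [simp]: "0 \<in> dom U"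
  using ker by (auto simp: ker_def)

lemma ap_diff:
  assumes "x \<in> dom U" "y \<in> dom U"
  shows "ap (x - y) = ap x - ap y"
  using ap_add[OF subspace_diff[OF subspace_dom assms] assms(2)] by simp

lemma ap_inject:
  assumes "x \<in> dom U" "y \<in> dom U" "ap x = ap y"
  shows "x = y"
proof -
  have "x - y \<in> ker U"
    using assms by (simp add: ker_def ap_diff subspace_diff[OF subspace_dom])
  then show ?thesis
    by (simp add: ker)
qed

lemma ran_eq: "ran U = ap ` dom U"
  by (force simp: ran_def image_iff)

lemma graph_eq: "Map.graph U = (\<lambda>h. (h, ap h)) ` dom U"
  by (force simp: Map.graph_def image_iff)

lemma inverse_op_ap [simp]:
  assumes "h \<in> dom U"
  shows "inverse_op U (ap h) = Some h"
proof -
  have "(THE g. U g = Some (ap h)) = h"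
  proof (rule the_equality)
    show "U h = Some (ap h)"
      using assms by (cases "U h") auto
    show "g = h" if "U g = Some (ap h)" for g
    proof (rule ap_inject[OF _ assms])
      show "g \<in> dom U"
        using that by (rule domI)
      show "ap g = ap h"
        by (simp only: that option.sel)
    qed
  qed
  then show ?thesis
    using assms by (simp add: inverse_op_def ran_eq)
qed

text \<open>
  Otherwise the classical reasoner turns \<open>h \<in> dom U\<close> into \<open>U h = Some y\<close>, so that
  \<open>ap h\<close> is no longer recognised.
\<close>

declare domIff [iff del]

lemma inverse_op_None: "k \<notin> ran U \<Longrightarrow> inverse_op U k = None"
  by (simp add: inverse_op_def)

lemma subspace_ran: "subspace (ran U)"
  unfolding ran_eq
proof (rule subspaceI)
  show "0 \<in> ap ` dom U"
    using ap_0 dom_0 by (metis imageI)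
  show "x + y \<in> ap ` dom U" if "x \<in> ap ` dom U" "y \<in> ap ` dom U" for x y
    using that subspace_add[OF subspace_dom] by (auto simp: ap_add[symmetric])
  show "smul c x \<in> ap ` dom U" if "x \<in> ap ` dom U" for c x
    using that subspace_scale[OF subspace_dom] by (auto simp: ap_smul[symmetric])
qed

section \<open>Isometry and the adjoint\<close>

definition isometric :: bool
  where "isometric \<longleftrightarrow> (\<forall>h\<in>dom U. \<forall>g\<in>dom U. ip (ap h) (ap g) = ip h g)"

lemma isometricD: "isometric \<Longrightarrow> h \<in> dom U \<Longrightarrow> g \<in> dom U \<Longrightarrow> ip (ap h) (ap g) = ip h g"
  by (auto simp: isometric_def)

lemma adjoint_to_each_other_iff: "adjoint_to_each_other ip U (inverse_op U) \<longleftrightarrow> isometric"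
  unfolding adjoint_to_each_other_def isometric_def dom_inverse_op ran_eq
  by simp

text \<open>Density makes the vector chosen by \<open>THE\<close> unique, so the adjoint can be
  handled through its defining identity alone.\<close>

lemma adjoint_op_eq_Some_iff:
  assumes "densely_defined U"
  shows "adjoint_op ip U k = Some l \<longleftrightarrow> (\<forall>h\<in>dom U. ip (ap h) k = ip h l)"
proof -
  have uniq: "l = l'"
    if "\<forall>h\<in>dom U. ip (ap h) k = ip h l" "\<forall>h\<in>dom U. ip (ap h) k = ip h l'" for l l'
    using assms that unfolding densely_defined_def by (metis dense_orthogonal_imp_eq)
  then have "(THE l. \<forall>h\<in>dom U. ip (ap h) k = ip h l) = l"
    if "\<forall>h\<in>dom U. ip (ap h) k = ip h l" for l
    using that by (intro the_equality) blast+
  then show ?thesis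
    by (auto simp: adjoint_op_def)
qed

text \<open>The inverse sends \<open>ap g\<close> to \<open>g\<close>; that the adjoint does the
  same is the isometry identity with second argument \<open>g\<close>.\<close>

lemma inverse_le_adjoint_iff:
  assumes "densely_defined U"
  shows "inverse_op U \<subseteq>\<^sub>m adjoint_op ip U \<longleftrightarrow> isometric"
proof -
  have "inverse_op U \<subseteq>\<^sub>m adjoint_op ip U \<longleftrightarrow>
      (\<forall>g\<in>dom U. adjoint_op ip U (ap g) = Some g)"
    unfolding map_le_def dom_inverse_op ran_eq by auto
  then show ?thesis
    unfolding adjoint_op_eq_Some_iff[OF assms] isometric_def by blast
qed

section \<open>Closed isometries\<close>

lemma dist_ap_ap:
  assumes "isometric" "x \<in> dom U" "y \<in> dom U"
  shows "dist (ap x) (ap y) = dist x y"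
proof -
  have "x - y \<in> dom U"
    using subspace_diff[OF subspace_dom assms(2,3)] .
  then have "rip (ap (x - y)) (ap (x - y)) = rip (x - y) (x - y)"
    using isometricD[OF assms(1)] by (simp add: rip_def)
  then show ?thesis
    using assms by (simp add: rip_self ap_diff dist_norm)
qed

text \<open>A sequence in the domain is Cauchy iff its image is. By completeness, convergence of one
  gives convergence of the other, and the closed graph contains the pair of limits.\<close>

lemma isometric_closed_dom_ran:
  assumes iso: "isometric" and "closed_op U"
  shows "closed (dom U)" "closed (ran U)"
proof -
  have graph_lim: "x \<in> dom U \<and> ap x = y"
    if "\<And>n. s n \<in> dom U" "s \<longlonglongrightarrow> x" "(\<lambda>n. ap (s n)) \<longlonglongrightarrow> y" for s x y
  proof -
    have "(x, y) \<in> Map.graph U"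
    proof (rule closed_sequentially)
      show "closed (Map.graph U)"
        using assms(2) by (simp add: closed_op_def)
      show "(\<lambda>n. (s n, ap (s n))) \<longlonglongrightarrow> (x, y)"
        by (intro tendsto_Pair that)
      show "(s n, ap (s n)) \<in> Map.graph U" for n
        using that(1) by (simp add: graph_eq)
    qed
    then show ?thesis
      by (auto simp: graph_eq)
  qed
  have Cauchy_iff: "Cauchy (\<lambda>n. ap (s n)) \<longleftrightarrow> Cauchy s" if "\<And>n. s n \<in> dom U" for s
    using that by (simp add: Cauchy_def dist_ap_ap[OF iso])
  show "closed (dom U)"
    unfolding closed_sequential_limits
  proof (intro allI impI, elim conjE)
    fix s x assume s: "\<forall>n. s n \<in> dom U" "s \<longlonglongrightarrow> x"
    then have "convergent (\<lambda>n. ap (s n))"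
      using Cauchy_iff[of s] by (simp add: LIMSEQ_imp_Cauchy Cauchy_convergent_iff[symmetric])
    then show "x \<in> dom U"
      using graph_lim[where s=s and x=x] s by (auto simp: convergent_def)
  qed
  show "closed (ran U)"
    unfolding closed_sequential_limits
  proof (intro allI impI, elim conjE)
    fix t y assume t: "\<forall>n. t n \<in> ran U" "t \<longlonglongrightarrow> y"
    then have "\<forall>n. \<exists>h. h \<in> dom U \<and> t n = ap h"
      by (auto simp: ran_eq)
    then obtain s where s: "\<And>n. s n \<in> dom U" "\<And>n. t n = ap (s n)"
      by metis
    then have eq: "(\<lambda>n. ap (s n)) = t"
      by auto
    then have "convergent s"
      using Cauchy_iff[of s] s(1) t by (simp add: LIMSEQ_imp_Cauchy Cauchy_convergent_iff[symmetric])
    then obtain x where x: "s \<longlonglongrightarrow> x"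
      by (auto simp: convergent_def)
    then have "x \<in> dom U \<and> ap x = y"
      using graph_lim[where x=x and y=y, OF s(1)] t eq by simp
    then show "y \<in> ran U"
      by (auto simp: ran_eq)
  qed
qed

section \<open>Operators whose adjoint is the inverse\<close>

lemma adjoint_eq_inverse_imp_isometric:
  assumes "densely_defined U" "adjoint_op ip U = inverse_op U"
  shows "isometric"
  using inverse_le_adjoint_iff[OF assms(1)] assms(2) by simp

text \<open>The tested identity says that the adjoint maps \<open>k\<close> to \<open>l\<close>; as
  the adjoint is the inverse, \<open>l\<close> is the preimage of \<open>k\<close>. Membership in
  the graph is thereby reduced to an identity of inner products.\<close>

lemma adjoint_eq_inverseD:
  assumes "densely_defined U" "adjoint_op ip U = inverse_op U"
    and "\<And>h. h \<in> dom U \<Longrightarrow> ip (ap h) k = ip h l"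
  shows "l \<in> dom U" "k = ap l"
proof -
  have inv: "inverse_op U k = Some l"
    using assms adjoint_op_eq_Some_iff[OF assms(1)] by metis
  then have "k \<in> ran U"
    by (metis inverse_op_None option.distinct(1))
  then obtain g where g: "g \<in> dom U" "k = ap g"
    by (auto simp: ran_eq)
  with inv have "g = l"
    by simp
  with g show "l \<in> dom U" "k = ap l"
    by simp_all
qed

text \<open>The identity tested in \<open>adjoint_eq_inverseD\<close> holds at graph points by
  isometry and survives limits.\<close>

lemma adjoint_eq_inverse_imp_closed_op:
  assumes dense: "densely_defined U" and adj: "adjoint_op ip U = inverse_op U"
  shows "closed_op U"
  unfolding closed_op_def closed_sequential_limits
proof (intro allI impI, elim conjE)
  note iso = adjoint_eq_inverse_imp_isometric[OF assms]
  fix p q assume p: "\<forall>n. p n \<in> Map.graph U" "p \<longlonglongrightarrow> q"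
  have p': "fst (p n) \<in> dom U" "snd (p n) = ap (fst (p n))" for n
    using p(1)[THEN spec, of n] by (auto simp: graph_eq)
  have "ip (ap d) (snd q) = ip d (fst q)" if d: "d \<in> dom U" for d
    unfolding ip_eq_iff_rip
  proof
    fix c
    have "rip (smul c (ap d)) (snd (p n)) = rip (smul c d) (fst (p n))" for n
      using isometricD[OF iso d p'(1)] unfolding p'(2) rip_def ip_smul_left by simp
    moreover have "(\<lambda>n. rip (smul c (ap d)) (snd (p n))) \<longlonglongrightarrow> rip (smul c (ap d)) (snd q)"
      "(\<lambda>n. rip (smul c d) (fst (p n))) \<longlonglongrightarrow> rip (smul c d) (fst q)"
      by (intro tendsto_rip tendsto_intros p(2))+
    ultimately show "rip (smul c (ap d)) (snd q) = rip (smul c d) (fst q)"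
      using LIMSEQ_unique by (simp only:)
  qed
  from adjoint_eq_inverseD[OF assms this] show "q \<in> Map.graph U"
    by (cases q) (auto simp: graph_eq)
qed

text \<open>The domain of a closed isometry is closed; being dense, it is everything. Isometry gives
  the bound 1.\<close>

lemma adjoint_eq_inverse_imp_unitary:
  assumes dense: "densely_defined U" and adj: "adjoint_op ip U = inverse_op U"
  shows "unitary_op ip U"
proof -
  note iso = adjoint_eq_inverse_imp_isometric[OF assms]
  have "dom U = UNIV"
    using isometric_closed_dom_ran[OF iso adjoint_eq_inverse_imp_closed_op[OF assms]] dense
    by (simp add: densely_defined_def)
  moreover have "bounded_op U"
    unfolding bounded_op_def
  proof (intro exI ballI)
    show "norm (ap h) \<le> 1 * norm h" if "h \<in> dom U" for h
      using dist_ap_ap[OF iso that dom_0] by simp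
  qed
  ultimately show ?thesis
    using adj by (simp add: unitary_op_def)
qed

text \<open>A vector \<open>y\<close> orthogonal to the range passes the test of
  \<open>adjoint_eq_inverseD\<close> with \<open>l = 0\<close>, so it equals
  \<open>ap 0\<close>.\<close>

lemma adjoint_eq_inverse_imp_dense_range:
  assumes dense: "densely_defined U" and adj: "adjoint_op ip U = inverse_op U"
  shows "dense_range U"
  unfolding dense_range_def
proof (rule closure_subspace_eq_UNIV[OF subspace_ran], rule subsetI)
  fix y assume "y \<in> orth_compl ip (ran U)"
  then have "ip (ap h) y = ip h 0" if "h \<in> dom U" for h
    using that by (auto simp: orth_compl_def ran_eq)
  from adjoint_eq_inverseD(2)[OF assms this] show "y \<in> {0}"
    by simp
qed

section \<open>The range of M and the orthogonal complement of the graph\<close>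

lemma M_op_ap:
  assumes "h \<in> dom U" "g \<in> dom U"
  shows "M_op U (inverse_op U) (h, ap g) = Some (h - g, ap h + ap g)"
  using assms by (simp add: M_op_def dom_inverse_op ran_eq)

lemma ran_M_op:
  "ran (M_op U (inverse_op U)) = {(h - g, ap h + ap g) |h g. h \<in> dom U \<and> g \<in> dom U}"
proof (intro equalityI subsetI)
  fix p assume "p \<in> ran (M_op U (inverse_op U))"
  then obtain h k where hk: "M_op U (inverse_op U) (h, k) = Some p"
    by (auto simp: ran_def)
  then have dom: "h \<in> dom U" "k \<in> ran U"
    by (auto simp: M_op_def dom_inverse_op split: if_splits)
  then obtain g where g: "g \<in> dom U" "k = ap g"
    by (auto simp: ran_eq)
  then have "p = (h - g, ap h + ap g)"
    using hk M_op_ap[OF dom(1) g(1)] by simp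
  then show "p \<in> {(h - g, ap h + ap g) |h g. h \<in> dom U \<and> g \<in> dom U}"
    using dom(1) g(1) by blast
next
  fix p assume "p \<in> {(h - g, ap h + ap g) |h g. h \<in> dom U \<and> g \<in> dom U}"
  then show "p \<in> ran (M_op U (inverse_op U))"
    using M_op_ap by (blast intro: ranI)
qed

text \<open>Up to a sign and a swap of components, the complement of the graph is the adjoint
  relation; this links it to the identities tested against \<open>dom U\<close>.\<close>

lemma orth_compl_graph:
  "(x, y) \<in> orth_compl (ip_prod ip) (Map.graph U) \<longleftrightarrow> (\<forall>h\<in>dom U. ip (ap h) y = ip h (- x))"
  by (auto simp: orth_compl_def graph_eq ip_prod_def ip_minus_right eq_neg_iff_add_eq_0 add.commute)

text \<open>A pair in the complement has the form \<open>(- g, ap g)\<close>, which is the value of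
  M at \<open>(0, ap g)\<close>.\<close>

lemma adjoint_eq_inverse_imp_orth_compl_graph_subset:
  assumes "densely_defined U" "adjoint_op ip U = inverse_op U"
  shows "orth_compl (ip_prod ip) (Map.graph U) \<subseteq> ran (M_op U (inverse_op U))"
proof clarify
  fix x y assume "(x, y) \<in> orth_compl (ip_prod ip) (Map.graph U)"
  then have "ip (ap h) y = ip h (- x)" if "h \<in> dom U" for h
    using that by (simp add: orth_compl_graph)
  from adjoint_eq_inverseD[OF assms this]
  have "- x \<in> dom U" "y = ap (- x)"
    by blast+
  then have "(x, y) = (0 - (- x), ap 0 + ap (- x))"
    by simp
  then show "(x, y) \<in> ran (M_op U (inverse_op U))"
    unfolding ran_M_op using \<open>- x \<in> dom U\<close> dom_0 by blast
qed

text \<open>Counterpart of \<open>adjoint_eq_inverseD\<close> under the range condition, available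
  before density is known: \<open>(- l, k)\<close> is a value of M, and the summand \<open>h\<close>
  in it turns out to be zero.\<close>

lemma isometric_imp_eq_ap:
  assumes iso: "isometric"
    and sub: "orth_compl (ip_prod ip) (Map.graph U) \<subseteq> ran (M_op U (inverse_op U))"
    and adj: "\<And>h. h \<in> dom U \<Longrightarrow> ip (ap h) k = ip h l"
  shows "l \<in> dom U" "k = ap l"
proof -
  have "(- l, k) \<in> orth_compl (ip_prod ip) (Map.graph U)"
    using adj by (simp add: orth_compl_graph)
  with sub obtain h g where hg: "h \<in> dom U" "g \<in> dom U" "- l = h - g" "k = ap h + ap g"
    unfolding ran_M_op by blast
  have "l = g - h"
    using hg(3) by (metis minus_diff_eq minus_minus)
  \<comment> \<open>The identity is tested at \<open>h\<close> itself; isometry cancels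
    \<open>ip h g\<close> and leaves \<open>ip h h\<close> with opposite signs on the two
    sides.\<close>
  then have "ip (ap h) (ap h + ap g) = ip h (g - h)"
    using adj[OF hg(1)] hg(4) by simp
  then have "ip h h + ip h h = 0"
    using hg by (simp add: ip_add_right ip_diff_right isometricD[OF iso] eq_neg_iff_add_eq_0)
  then have "rip h h + rip h h = 0"
    unfolding rip_def by (metis to_complex_add to_complex_0 plus_complex.sel(1) zero_complex.sel(1))
  then have "h = 0"
    by (simp add: rip_self)
  then show "l \<in> dom U" "k = ap l"
    using hg \<open>l = g - h\<close> by simp_all
qed

lemma isometric_imp_adjoint_eq_inverse:
  assumes iso: "isometric"
    and sub: "orth_compl (ip_prod ip) (Map.graph U) \<subseteq> ran (M_op U (inverse_op U))"
  shows "densely_defined U" "adjoint_op ip U = inverse_op U"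
proof -
  show dense: "densely_defined U"
    unfolding densely_defined_def
  proof (rule closure_subspace_eq_UNIV[OF subspace_dom], rule subsetI)
    fix x assume "x \<in> orth_compl ip (dom U)"
    \<comment> \<open>Orthogonality to the domain is the tested identity for \<open>k = 0\<close>
      and \<open>l = x\<close>, so \<open>ap x = 0\<close>.\<close>
    then have "ip (ap h) 0 = ip h x" if "h \<in> dom U" for h
      using that by (simp add: orth_compl_def)
    from isometric_imp_eq_ap[OF assms this] have "x \<in> dom U" "ap x = ap 0"
      by simp_all
    then show "x \<in> {0}"
      using ap_inject[of x 0] by simp
  qed
  show "adjoint_op ip U = inverse_op U"
  proof (rule map_le_antisym)
    show "inverse_op U \<subseteq>\<^sub>m adjoint_op ip U"
      using inverse_le_adjoint_iff[OF dense] iso by simp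
    show "adjoint_op ip U \<subseteq>\<^sub>m inverse_op U"
      unfolding map_le_def
    proof
      fix k assume "k \<in> dom (adjoint_op ip U)"
      then obtain l where l: "adjoint_op ip U k = Some l"
        by (blast dest: domD)
      then have "ip (ap h) k = ip h l" if "h \<in> dom U" for h
        using adjoint_op_eq_Some_iff[OF dense] that by blast
      from isometric_imp_eq_ap[OF assms this] show "adjoint_op ip U k = inverse_op U k"
        using l by simp
    qed
  qed
qed

text \<open>The range is closed and dense, so the inverse is everywhere defined and has no proper
  extension.\<close>

lemma closed_isometric_dense_range_imp_adjoint_eq_inverse:
  assumes dense: "densely_defined U" and closed: "closed_op U" and range: "dense_range U"
    and sub: "inverse_op U \<subseteq>\<^sub>m adjoint_op ip U"
  shows "adjoint_op ip U = inverse_op U"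
proof -
  have iso: "isometric"
    using inverse_le_adjoint_iff[OF dense] sub by simp
  have "ran U = UNIV"
    using isometric_closed_dom_ran[OF iso closed] range
    by (simp add: dense_range_def)
  then show ?thesis
    using sub by (auto simp: map_le_def dom_inverse_op)
qed

end

section \<open>The equivalences\<close>

theorem theorem9p2:
  fixes smul :: "'k::real_or_complex \<Rightarrow> 'h::banach \<Rightarrow> 'h"
    and ip :: "'h \<Rightarrow> 'h \<Rightarrow> 'k"
    and U :: "'h \<rightharpoonup> 'h"
  assumes "hilbert_space smul ip"
    and "linear_operator smul U"
    and "ker U = {0}"
  shows "all_equivalent
    [unitary_op ip U,
     adjoint_to_each_other ip U (inverse_op U) \<and>
       orth_compl (ip_prod ip) (Map.graph U) \<subseteq> ran (M_op U (inverse_op U)),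
     densely_defined U \<and> adjoint_op ip U = inverse_op U,
     densely_defined U \<and> closed_op U \<and> dense_range U \<and>
       inverse_op U \<subseteq>\<^sub>m adjoint_op ip U]"
proof -
  interpret injective_operator smul ip U
    using assms by (simp add: injective_operator_def injective_operator_axioms_def)
  \<comment> \<open>The third assertion is the hub to which each of the others is shown
    equivalent.\<close>
  let ?iii = "densely_defined U \<and> adjoint_op ip U = inverse_op U"
  have "unitary_op ip U \<longleftrightarrow> ?iii"
    using adjoint_eq_inverse_imp_unitary by (auto simp: unitary_op_def densely_defined_def)
  moreover have "adjoint_to_each_other ip U (inverse_op U) \<and>
      orth_compl (ip_prod ip) (Map.graph U) \<subseteq> ran (M_op U (inverse_op U)) \<longleftrightarrow> ?iii"
    unfolding adjoint_to_each_other_iff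
    using adjoint_eq_inverse_imp_isometric adjoint_eq_inverse_imp_orth_compl_graph_subset
      isometric_imp_adjoint_eq_inverse by blast
  moreover have "densely_defined U \<and> closed_op U \<and> dense_range U \<and>
      inverse_op U \<subseteq>\<^sub>m adjoint_op ip U \<longleftrightarrow> ?iii"
    using adjoint_eq_inverse_imp_closed_op adjoint_eq_inverse_imp_dense_range
      closed_isometric_dense_range_imp_adjoint_eq_inverse map_le_refl by metis
  ultimately show ?thesis
    by (simp add: all_equivalent_def)
qed

end
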